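(* Let $A$ and $B$ be sets (i.e. $V\Rightarrow A$ and $V\Rightarrow B$), and let $x$ be a variable not appearing free in $A$ or $B$. Then $A\cap B=\{x\mid x\in A\,\&\,x\in B\}$ (derivably, under these hypotheses).
   Context: Formal system. Objects are generated from the constant $\varnothing$ by: $(\alpha)^{\mathsf c}$, $(\alpha)^{\mathsf v}$ (variables are objects of this form), $(\alpha\,\&\,\beta)$ (federation), $(\alpha\Rightarrow\beta)$ (containment/implication), $(\alpha\cap\beta)$ (intersection), and classes $\{x\mid\beta\}$ ($x$ a variable, which becomes a bound index). $\alpha[x:=\beta]$ replaces every free appearance of $x$ by $\beta$. Abbreviations: $\bot:=\varnothing^{\mathsf c}$; $\neg a:=(a\Rightarrow\bot)$; $\bar a:=(\varnothing\Rightarrow a)$; $a\vee b:=\overline{\bar a\cap\bar b}$; $a=b:=(a\Rightarrow b)\&(b\Rightarrow a)$; $a\neq b:=\neg(a=b)$; $\mathrm{Sing}(a):=(\bar a\neq a)\,\&\,((a\Rightarrow b)\Rightarrow(\bar b\vee a=b))$, with $b$ a variable; $a\in b:=\mathrm{Sing}(a)\&(b\Rightarrow a)$; $V:=\{x\mid\varnothing\}$; an object $A$ is a set if $V\Rightarrow A$. Rules: R1 from $\alpha$ and $\alpha\Rightarrow\beta$ infer $\beta$; R2 from $\alpha$ infer $\alpha[x:=\beta]$; R3 if $x$ does not appear in $\gamma$, from $\gamma\Rightarrow(\alpha\Rightarrow\beta)$ infer $\gamma\Rightarrow(\{x\mid\beta\}\Rightarrow\{x\mid\alpha\})$. Axioms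 ($a,b,c,d,x$ variables): A1 $((c\Rightarrow a)\&(c\Rightarrow(a\Rightarrow b)))\Rightarrow(c\Rightarrow b)$; A2 $((d\Rightarrow(a\Rightarrow b))\&(d\Rightarrow(b\Rightarrow c)))\Rightarrow(d\Rightarrow(a\Rightarrow c))$; A3 $((c\Rightarrow a)\&(c\Rightarrow b))\Rightarrow(c\Rightarrow(a\&b))$; A4 $(a\&b)\Rightarrow a$, $(a\&b)\Rightarrow b$; A5 $a\Rightarrow(a\cap b)$, $b\Rightarrow(a\cap b)$; A6 $((a\Rightarrow c)\&(b\Rightarrow c))\Rightarrow((a\cap b)\Rightarrow c)$; A7 $a\Rightarrow a$; A8 $a\Rightarrow\varnothing$; A9 $\bot\Rightarrow a$; A10 $(\varnothing\Rightarrow a)\Rightarrow((\varnothing\Rightarrow b)\Rightarrow(a\&b))$; A11 $(a\Rightarrow b)\Rightarrow(\varnothing\Rightarrow(a\Rightarrow b))$; A12 $(((a\Rightarrow b)\Rightarrow\bot)\Rightarrow\bot)\Rightarrow(a\Rightarrow b)$; A13 (schema) $a\in\{x\mid\alpha\}=(\mathrm{Sing}(a)\&\alpha[x:=a])$; A14a $a\Rightarrow\{x\mid x\in a\}$; A14b $(V\Rightarrow a)\Rightarrow(\{x\mid x\in a\}\Rightarrow a)$. *)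

theory Defs
  imports Main
begin

text \<open>
  Expressions are in locally nameless form: forming the class \<open>{x | \<beta>}\<close> turns the
  free appearances of the variable \<open>x\<close> in \<open>\<beta>\<close> into bound indices (\<open>Bnd\<close>, de Bruijn).
  Hence classes differing only in the name of the bound variable are identical, and
  substituting an object never captures a variable.  The objects of the system are the
  expressions without dangling indices.
\<close>

datatype obj =
    Emp  (\<open>\<^bold>\<emptyset>\<close>)
  | Cst obj
  | Var obj
  | Bnd nat
  | Fed obj obj  (infixr \<open>\<^bold>&\<close> 65)
  | Imp obj obj  (infixr \<open>\<^bold>\<Rightarrow>\<close> 60)
  | Cap obj obj  (infixl \<open>\<^bold>\<inter>\<close> 70)
  | Cls obj

primrec closed_at :: "nat \<Rightarrow> obj \<Rightarrow> bool" where
  "closed_at k \<^bold>\<emptyset> = True"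
| "closed_at k (Cst t) = closed_at k t"
| "closed_at k (Var t) = closed_at 0 t"
| "closed_at k (Bnd i) = (i < k)"
| "closed_at k (t \<^bold>& u) = (closed_at k t \<and> closed_at k u)"
| "closed_at k (t \<^bold>\<Rightarrow> u) = (closed_at k t \<and> closed_at k u)"
| "closed_at k (t \<^bold>\<inter> u) = (closed_at k t \<and> closed_at k u)"
| "closed_at k (Cls t) = closed_at (Suc k) t"

definition is_object :: "obj \<Rightarrow> bool" where
  "is_object t \<longleftrightarrow> closed_at 0 t"

definition is_var :: "obj \<Rightarrow> bool" where
  "is_var x \<longleftrightarrow> (\<exists>t. is_object t \<and> x = Var t)"

text \<open>
  A variable \<open>Var t\<close> is atomic in the three functions below: \<open>t\<close> only names it, so no
  variable counts as appearing inside \<open>t\<close>.  (Otherwise instantiating one variable could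
  change the identity of another.)  By contrast \<open>Cst\<close> is treated as an ordinary
  object former.
\<close>

primrec free_in :: "obj \<Rightarrow> obj \<Rightarrow> bool" where
  "free_in x \<^bold>\<emptyset> = False"
| "free_in x (Cst t) = free_in x t"
| "free_in x (Var t) = (Var t = x)"
| "free_in x (Bnd i) = False"
| "free_in x (t \<^bold>& u) = (free_in x t \<or> free_in x u)"
| "free_in x (t \<^bold>\<Rightarrow> u) = (free_in x t \<or> free_in x u)"
| "free_in x (t \<^bold>\<inter> u) = (free_in x t \<or> free_in x u)"
| "free_in x (Cls t) = free_in x t"

primrec subst :: "obj \<Rightarrow> obj \<Rightarrow> obj \<Rightarrow> obj"  (\<open>_[_ ::= _]\<close> [1000, 0, 0] 1000) where
  "\<^bold>\<emptyset>[x ::= s] = \<^bold>\<emptyset>"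
| "(Cst t)[x ::= s] = Cst (t[x ::= s])"
| "(Var t)[x ::= s] = (if Var t = x then s else Var t)"
| "(Bnd i)[x ::= s] = Bnd i"
| "(t \<^bold>& u)[x ::= s] = (t[x ::= s] \<^bold>& u[x ::= s])"
| "(t \<^bold>\<Rightarrow> u)[x ::= s] = (t[x ::= s] \<^bold>\<Rightarrow> u[x ::= s])"
| "(t \<^bold>\<inter> u)[x ::= s] = (t[x ::= s] \<^bold>\<inter> u[x ::= s])"
| "(Cls t)[x ::= s] = Cls (t[x ::= s])"

primrec bind :: "nat \<Rightarrow> obj \<Rightarrow> obj \<Rightarrow> obj" where
  "bind k x \<^bold>\<emptyset> = \<^bold>\<emptyset>"
| "bind k x (Cst t) = Cst (bind k x t)"
| "bind k x (Var t) = (if Var t = x then Bnd k else Var t)"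
| "bind k x (Bnd i) = Bnd i"
| "bind k x (t \<^bold>& u) = (bind k x t \<^bold>& bind k x u)"
| "bind k x (t \<^bold>\<Rightarrow> u) = (bind k x t \<^bold>\<Rightarrow> bind k x u)"
| "bind k x (t \<^bold>\<inter> u) = (bind k x t \<^bold>\<inter> bind k x u)"
| "bind k x (Cls t) = Cls (bind (Suc k) x t)"

definition ClassOf :: "obj \<Rightarrow> obj \<Rightarrow> obj"  (\<open>\<^bold>{_ \<^bold>| _\<^bold>}\<close>) where
  "\<^bold>{x \<^bold>| t\<^bold>} = Cls (bind 0 x t)"

definition Bot :: obj  (\<open>\<^bold>\<bottom>\<close>) where
  "\<^bold>\<bottom> = Cst \<^bold>\<emptyset>"

definition Neg :: "obj \<Rightarrow> obj"  (\<open>\<^bold>\<not> _\<close> [80] 80) where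
  "\<^bold>\<not> a = (a \<^bold>\<Rightarrow> \<^bold>\<bottom>)"

definition Bar :: "obj \<Rightarrow> obj" where
  "Bar a = (\<^bold>\<emptyset> \<^bold>\<Rightarrow> a)"

definition Or :: "obj \<Rightarrow> obj \<Rightarrow> obj"  (infixr \<open>\<^bold>\<or>\<close> 64) where
  "a \<^bold>\<or> b = Bar (Bar a \<^bold>\<inter> Bar b)"

definition Eq :: "obj \<Rightarrow> obj \<Rightarrow> obj"  (infix \<open>\<^bold>=\<close> 68) where
  "a \<^bold>= b = ((a \<^bold>\<Rightarrow> b) \<^bold>& (b \<^bold>\<Rightarrow> a))"

definition Neq :: "obj \<Rightarrow> obj \<Rightarrow> obj"  (infix \<open>\<^bold>\<noteq>\<close> 68) where
  "a \<^bold>\<noteq> b = \<^bold>\<not> (a \<^bold>= b)"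

text \<open>
  \<open>Sing(a)\<close> mentions an auxiliary variable \<open>b\<close>, which is free in it.  It is made an
  explicit parameter; wherever \<open>Sing b a\<close> is used with a variable \<open>a\<close>, \<open>b\<close> is required
  to be a variable other than \<open>a\<close>.
\<close>

definition Sing :: "obj \<Rightarrow> obj \<Rightarrow> obj" where
  "Sing b a = ((Bar a \<^bold>\<noteq> a) \<^bold>& ((a \<^bold>\<Rightarrow> b) \<^bold>\<Rightarrow> (Bar b \<^bold>\<or> (a \<^bold>= b))))"

definition Mem :: "obj \<Rightarrow> obj \<Rightarrow> obj \<Rightarrow> obj"  (\<open>_ \<^bold>\<in>[_] _\<close> [69, 0, 69] 68) where
  "a \<^bold>\<in>[b] c = (Sing b a \<^bold>& (c \<^bold>\<Rightarrow> a))"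

text \<open>The choice of the bound variable in \<open>V = {x | \<emptyset>}\<close> is immaterial.\<close>

definition Univ :: obj  (\<open>\<^bold>V\<close>) where
  "\<^bold>V = \<^bold>{Var \<^bold>\<emptyset> \<^bold>| \<^bold>\<emptyset>\<^bold>}"

inductive derivable :: "obj \<Rightarrow> bool"  (\<open>\<turnstile> _\<close> [50] 50) where
  R1: "\<turnstile> t \<Longrightarrow> \<turnstile> t \<^bold>\<Rightarrow> u \<Longrightarrow> \<turnstile> u"
| R2: "\<turnstile> t \<Longrightarrow> is_var x \<Longrightarrow> is_object s \<Longrightarrow> \<turnstile> t[x ::= s]"
| R3: "\<turnstile> g \<^bold>\<Rightarrow> (t \<^bold>\<Rightarrow> u) \<Longrightarrow> is_var x \<Longrightarrow> \<not> free_in x g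
       \<Longrightarrow> \<turnstile> g \<^bold>\<Rightarrow> (\<^bold>{x \<^bold>| u\<^bold>} \<^bold>\<Rightarrow> \<^bold>{x \<^bold>| t\<^bold>})"
| A1: "is_var a \<Longrightarrow> is_var b \<Longrightarrow> is_var c
       \<Longrightarrow> \<turnstile> ((c \<^bold>\<Rightarrow> a) \<^bold>& (c \<^bold>\<Rightarrow> (a \<^bold>\<Rightarrow> b))) \<^bold>\<Rightarrow> (c \<^bold>\<Rightarrow> b)"
| A2: "is_var a \<Longrightarrow> is_var b \<Longrightarrow> is_var c \<Longrightarrow> is_var d
       \<Longrightarrow> \<turnstile> ((d \<^bold>\<Rightarrow> (a \<^bold>\<Rightarrow> b)) \<^bold>& (d \<^bold>\<Rightarrow> (b \<^bold>\<Rightarrow> c))) \<^bold>\<Rightarrow> (d \<^bold>\<Rightarrow> (a \<^bold>\<Rightarrow> c))"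
| A3: "is_var a \<Longrightarrow> is_var b \<Longrightarrow> is_var c
       \<Longrightarrow> \<turnstile> ((c \<^bold>\<Rightarrow> a) \<^bold>& (c \<^bold>\<Rightarrow> b)) \<^bold>\<Rightarrow> (c \<^bold>\<Rightarrow> (a \<^bold>& b))"
| A4l: "is_var a \<Longrightarrow> is_var b \<Longrightarrow> \<turnstile> (a \<^bold>& b) \<^bold>\<Rightarrow> a"
| A4r: "is_var a \<Longrightarrow> is_var b \<Longrightarrow> \<turnstile> (a \<^bold>& b) \<^bold>\<Rightarrow> b"
| A5l: "is_var a \<Longrightarrow> is_var b \<Longrightarrow> \<turnstile> a \<^bold>\<Rightarrow> (a \<^bold>\<inter> b)"
| A5r: "is_var a \<Longrightarrow> is_var b \<Longrightarrow> \<turnstile> b \<^bold>\<Rightarrow> (a \<^bold>\<inter> b)"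
| A6: "is_var a \<Longrightarrow> is_var b \<Longrightarrow> is_var c
       \<Longrightarrow> \<turnstile> ((a \<^bold>\<Rightarrow> c) \<^bold>& (b \<^bold>\<Rightarrow> c)) \<^bold>\<Rightarrow> ((a \<^bold>\<inter> b) \<^bold>\<Rightarrow> c)"
| A7: "is_var a \<Longrightarrow> \<turnstile> a \<^bold>\<Rightarrow> a"
| A8: "is_var a \<Longrightarrow> \<turnstile> a \<^bold>\<Rightarrow> \<^bold>\<emptyset>"
| A9: "is_var a \<Longrightarrow> \<turnstile> \<^bold>\<bottom> \<^bold>\<Rightarrow> a"
| A10: "is_var a \<Longrightarrow> is_var b
       \<Longrightarrow> \<turnstile> (\<^bold>\<emptyset> \<^bold>\<Rightarrow> a) \<^bold>\<Rightarrow> ((\<^bold>\<emptyset> \<^bold>\<Rightarrow> b) \<^bold>\<Rightarrow> (a \<^bold>& b))"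
| A11: "is_var a \<Longrightarrow> is_var b \<Longrightarrow> \<turnstile> (a \<^bold>\<Rightarrow> b) \<^bold>\<Rightarrow> (\<^bold>\<emptyset> \<^bold>\<Rightarrow> (a \<^bold>\<Rightarrow> b))"
| A12: "is_var a \<Longrightarrow> is_var b
       \<Longrightarrow> \<turnstile> (((a \<^bold>\<Rightarrow> b) \<^bold>\<Rightarrow> \<^bold>\<bottom>) \<^bold>\<Rightarrow> \<^bold>\<bottom>) \<^bold>\<Rightarrow> (a \<^bold>\<Rightarrow> b)"
| A13: "is_var a \<Longrightarrow> is_var b \<Longrightarrow> is_var x \<Longrightarrow> b \<noteq> a \<Longrightarrow> is_object t
       \<Longrightarrow> \<turnstile> (a \<^bold>\<in>[b] \<^bold>{x \<^bold>| t\<^bold>}) \<^bold>= (Sing b a \<^bold>& t[x ::= a])"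
| A14a: "is_var a \<Longrightarrow> is_var b \<Longrightarrow> is_var x \<Longrightarrow> b \<noteq> x \<Longrightarrow> a \<noteq> x
       \<Longrightarrow> \<turnstile> a \<^bold>\<Rightarrow> \<^bold>{x \<^bold>| x \<^bold>\<in>[b] a\<^bold>}"
| A14b: "is_var a \<Longrightarrow> is_var b \<Longrightarrow> is_var x \<Longrightarrow> b \<noteq> x \<Longrightarrow> a \<noteq> x
       \<Longrightarrow> \<turnstile> (\<^bold>V \<^bold>\<Rightarrow> a) \<^bold>\<Rightarrow> (\<^bold>{x \<^bold>| x \<^bold>\<in>[b] a\<^bold>} \<^bold>\<Rightarrow> a)"

text \<open>\<open>SetObj A\<close> is the object expressing that \<open>A\<close> is a set.\<close>

definition SetObj :: "obj \<Rightarrow> obj" where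
  "SetObj A = (\<^bold>V \<^bold>\<Rightarrow> A)"

end

(* In the implication order, the intersection is the join (A5, A6), so "A \<inter> B \<Rightarrow> x" amounts to
   "A \<Rightarrow> x" and "B \<Rightarrow> x"; thus "x \<in> A \<inter> B" implies "x \<in> A & x \<in> B" already propositionally, and R3
   turns this into a containment of classes.  A14a and A14b pass from A and B to their classes of
   elements and from the class of elements of A \<inter> B back to A \<inter> B, which is a set because A is one.
   Weakening is available only for derivable implications, since its proof needs A11. *)
theory Submission
  imports Defs
begin

section \<open>Objecthood, substitution and binding\<close>

lemma is_object_simps [simp]:
  "is_object \<^bold>\<emptyset>"
  "is_object (t \<^bold>& u) \<longleftrightarrow> is_object t \<and> is_object u"
  "is_object (t \<^bold>\<Rightarrow> u) \<longleftrightarrow> is_object t \<and> is_object u"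
  "is_object (t \<^bold>\<inter> u) \<longleftrightarrow> is_object t \<and> is_object u"
  by (simp_all add: is_object_def)

lemma is_var_is_object: "is_var x \<Longrightarrow> is_object x"
  by (auto simp: is_var_def is_object_def)

lemma is_object_abbrevs [simp]:
  "is_object \<^bold>\<bottom>"
  "is_object (Bar t) \<longleftrightarrow> is_object t"
  "is_object (t \<^bold>= u) \<longleftrightarrow> is_object t \<and> is_object u"
  "is_object (Sing u t) \<longleftrightarrow> is_object t \<and> is_object u"
  "is_object (t \<^bold>\<in>[u] w) \<longleftrightarrow> is_object t \<and> is_object u \<and> is_object w"
  by (auto simp: Bot_def Bar_def Eq_def Neq_def Neg_def Or_def Sing_def Mem_def)
    (auto simp: is_object_def)

lemma closed_at_mono: "closed_at k t \<Longrightarrow> k \<le> l \<Longrightarrow> closed_at l t"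
  by (induction t arbitrary: k l) fastforce+

text \<open>Substitution shifts no indices: an object \<open>s\<close> has no dangling ones, so by
  \<open>closed_at_mono\<close> it may stand under any number of class formers.\<close>

lemma closed_at_subst: "closed_at k t \<Longrightarrow> is_object s \<Longrightarrow> closed_at k (t[x ::= s])"
  by (induction t arbitrary: k) (auto simp: is_object_def intro: closed_at_mono)

lemma closed_at_bind: "closed_at k t \<Longrightarrow> closed_at (Suc k) (bind k x t)"
  by (induction t arbitrary: k) (auto intro: closed_at_mono)

lemma is_object_subst: "is_object t \<Longrightarrow> is_object s \<Longrightarrow> is_object (t[x ::= s])"
  unfolding is_object_def using closed_at_subst is_object_def by blast

lemma is_object_ClassOf: "is_object t \<Longrightarrow> is_object \<^bold>{x \<^bold>| t\<^bold>}"
  by (simp add: is_object_def ClassOf_def closed_at_bind)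

lemma is_object_Univ: "is_object \<^bold>V"
  by (simp add: Univ_def is_object_ClassOf)

text \<open>The axioms are built from variables and, in A13, from a given object, and each rule
  preserves objecthood. The derived rules below read the side conditions of
  \<open>derivable_instance\<close> off their derivable premises.\<close>

lemma derivable_is_object: "\<turnstile> t \<Longrightarrow> is_object t"
  by (induction rule: derivable.induct)
    (auto simp: is_var_is_object is_object_subst is_object_ClassOf is_object_Univ)

lemma subst_not_free: "\<not> free_in x t \<Longrightarrow> t[x ::= s] = t"
  by (induction t) auto

lemma bind_not_free: "\<not> free_in x t \<Longrightarrow> bind k x t = t"
  by (induction t arbitrary: k) auto

text \<open>If \<open>x\<close> were free in \<open>s\<close>, the right-hand side would bind it
  while the left-hand side would leave it free; otherwise \<open>bind\<close> leaves the inserted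
  copies of \<open>s\<close> unchanged.\<close>

lemma subst_bind:
  "a \<noteq> x \<Longrightarrow> \<not> free_in x s \<Longrightarrow> (bind k x t)[a ::= s] = bind k x (t[a ::= s])"
  by (induction t arbitrary: k) (auto simp: bind_not_free)

lemma subst_ClassOf:
  "a \<noteq> x \<Longrightarrow> \<not> free_in x s \<Longrightarrow> \<^bold>{x \<^bold>| t\<^bold>}[a ::= s] = \<^bold>{x \<^bold>| t[a ::= s]\<^bold>}"
  by (simp add: ClassOf_def subst_bind)

lemma subst_Univ: "\<^bold>V[a ::= s] = \<^bold>V"
  by (simp add: Univ_def ClassOf_def)

lemma subst_Mem: "(t \<^bold>\<in>[u] w)[a ::= s] = (t[a ::= s] \<^bold>\<in>[u[a ::= s]] w[a ::= s])"
  by (simp add: Mem_def Sing_def Neq_def Neg_def Eq_def Or_def Bar_def Bot_def)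

lemma subst_is_var: "is_var x \<Longrightarrow> x[y ::= s] = (if x = y then s else x)"
  by (auto simp: is_var_def)

section \<open>Fresh variables and instances of the axioms\<close>

lemma finite_free_in: "finite {x. free_in x t}"
  by (induction t) auto

lemma infinite_is_var: "infinite {x. is_var x}"
proof -
  \<comment> \<open>Names are towers of \<open>Cst\<close> over \<open>Emp\<close>; the height of a
    tower is its \<open>size\<close>, so different heights give different variables.\<close>
  define v where "v n = Var ((Cst ^^ n) \<^bold>\<emptyset>)" for n
  have size: "size ((Cst ^^ n) \<^bold>\<emptyset>) = n" for n
    by (induction n) auto
  have "inj v"
    by (rule injI) (metis v_def obj.inject(2) size)
  moreover have "is_var (v n)" for n
    by (induction n) (auto simp: v_def is_var_def is_object_def)
  ultimately show ?thesis
    by (metis finite_subset image_subsetI infinite_UNIV_nat finite_imageD mem_Collect_eq)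
qed

lemma ex_fresh:
  assumes "finite S"
  obtains a where "is_var a" "a \<notin> S" "\<not> free_in a t"
proof -
  have "finite (S \<union> {x. free_in x t})"
    using assms finite_free_in by simp
  then have "\<not> {x. is_var x} \<subseteq> S \<union> {x. free_in x t}"
    using infinite_is_var finite_subset by blast
  then show ?thesis
    using that by blast
qed

text \<open>The axioms speak of variables only; repeated R2 turns them into schemas for arbitrary
  objects. The condition on \<open>f\<close> says that it is a pattern in its four arguments,
  containing nothing else that a substitution could change. Axioms with fewer variables are passed
  as patterns that ignore some arguments.\<close>

lemma derivable_instance:
  assumes ax: "\<And>a b c d. is_var a \<Longrightarrow> is_var b \<Longrightarrow> is_var c \<Longrightarrow> is_var d \<Longrightarrow> \<turnstile> f a b c d"
    and "is_object p" "is_object q" "is_object r" "is_object w"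
    and f: "\<And>y s a b c d. (f a b c d)[y ::= s] = f (a[y ::= s]) (b[y ::= s]) (c[y ::= s]) (d[y ::= s])"
  shows "\<turnstile> f p q r w"
proof -
  obtain a where a: "is_var a"
    using ex_fresh[of "{}" "\<^bold>\<emptyset>"] by auto
  \<comment> \<open>Each further variable is new and not free in the objects inserted before its
    turn, so the successive substitutions act like a simultaneous one.\<close>
  obtain b where b: "is_var b" "b \<notin> {a}" "\<not> free_in b p"
    using ex_fresh[of "{a}" p] by auto
  obtain c where c: "is_var c" "c \<notin> {a, b}" "\<not> free_in c (p \<^bold>& q)"
    using ex_fresh[of "{a, b}" "p \<^bold>& q"] by auto
  obtain d where d: "is_var d" "d \<notin> {a, b, c}" "\<not> free_in d (p \<^bold>& q \<^bold>& r)"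
    using ex_fresh[of "{a, b, c}" "p \<^bold>& q \<^bold>& r"] by auto
  have "\<turnstile> (f a b c d)[a ::= p][b ::= q][c ::= r][d ::= w]"
    using assms a b c d by (intro R2) auto
  then show ?thesis
    using a b c d by (simp add: f subst_is_var subst_not_free)
qed

section \<open>Derived rules for implication, federation and intersection\<close>

lemma derivable_imp_is_object:
  assumes "\<turnstile> t \<^bold>\<Rightarrow> u"
  shows "is_object t" "is_object u"
  using derivable_is_object[OF assms] by simp_all

text \<open>A8 is instantiated at the derivable object \<open>a \<Rightarrow> a\<close>. With this
  lemma, R1 can detach the trivial context \<open>Emp\<close>.\<close>

lemma derivable_Emp: "\<turnstile> \<^bold>\<emptyset>"
proof -
  obtain a where a: "is_var a"
    using ex_fresh[of "{}" "\<^bold>\<emptyset>"] by auto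
  then have "\<turnstile> (a \<^bold>\<Rightarrow> \<^bold>\<emptyset>)[a ::= a \<^bold>\<Rightarrow> a]"
    using R2 A7 A8 derivable_is_object by blast
  then show ?thesis
    using a R1[OF A7[OF a]] by (simp add: subst_is_var)
qed

lemma necessitation:
  assumes "\<turnstile> t \<^bold>\<Rightarrow> u"
  shows "\<turnstile> \<^bold>\<emptyset> \<^bold>\<Rightarrow> (t \<^bold>\<Rightarrow> u)"
  by (rule R1[OF assms], rule derivable_instance[of "\<lambda>a b _ _. (a \<^bold>\<Rightarrow> b) \<^bold>\<Rightarrow> (\<^bold>\<emptyset> \<^bold>\<Rightarrow> (a \<^bold>\<Rightarrow> b))" t u t t])
    (use derivable_imp_is_object[OF assms] in \<open>auto intro: A11\<close>)

text \<open>A10 asks for both parts under the antecedent \<open>Emp\<close>, which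
  \<open>necessitation\<close> supplies for implications. This prepares the federated premises of
  A2, A3 and A6.\<close>

lemma Fed_imp_intro:
  assumes "\<turnstile> t \<^bold>\<Rightarrow> u" "\<turnstile> v \<^bold>\<Rightarrow> w"
  shows "\<turnstile> (t \<^bold>\<Rightarrow> u) \<^bold>& (v \<^bold>\<Rightarrow> w)"
proof -
  have "\<turnstile> (\<^bold>\<emptyset> \<^bold>\<Rightarrow> (t \<^bold>\<Rightarrow> u)) \<^bold>\<Rightarrow> ((\<^bold>\<emptyset> \<^bold>\<Rightarrow> (v \<^bold>\<Rightarrow> w)) \<^bold>\<Rightarrow> ((t \<^bold>\<Rightarrow> u) \<^bold>& (v \<^bold>\<Rightarrow> w)))"
    by (rule derivable_instance[of "\<lambda>a b _ _. (\<^bold>\<emptyset> \<^bold>\<Rightarrow> a) \<^bold>\<Rightarrow> ((\<^bold>\<emptyset> \<^bold>\<Rightarrow> b) \<^bold>\<Rightarrow> (a \<^bold>& b))"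
          "t \<^bold>\<Rightarrow> u" "v \<^bold>\<Rightarrow> w" t t])
      (use assms[THEN derivable_is_object] in \<open>auto intro: A10\<close>)
  then show ?thesis
    using R1 assms necessitation by blast
qed

lemma imp_trans_under:
  assumes "\<turnstile> g \<^bold>\<Rightarrow> (t \<^bold>\<Rightarrow> u)" "\<turnstile> g \<^bold>\<Rightarrow> (u \<^bold>\<Rightarrow> v)"
  shows "\<turnstile> g \<^bold>\<Rightarrow> (t \<^bold>\<Rightarrow> v)"
  by (rule R1[OF Fed_imp_intro[OF assms]],
      rule derivable_instance[of "\<lambda>a b c d. ((d \<^bold>\<Rightarrow> (a \<^bold>\<Rightarrow> b)) \<^bold>& (d \<^bold>\<Rightarrow> (b \<^bold>\<Rightarrow> c))) \<^bold>\<Rightarrow> (d \<^bold>\<Rightarrow> (a \<^bold>\<Rightarrow> c))" t u v g])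
    (use assms[THEN derivable_is_object] in \<open>auto intro: A2\<close>)

text \<open>A2 composes implications under a context; here the context is \<open>Emp\<close>,
  introduced by \<open>necessitation\<close> and then detached.\<close>

lemma imp_trans:
  assumes "\<turnstile> t \<^bold>\<Rightarrow> u" "\<turnstile> u \<^bold>\<Rightarrow> v"
  shows "\<turnstile> t \<^bold>\<Rightarrow> v"
  using R1[OF derivable_Emp imp_trans_under] assms necessitation by blast

text \<open>Any \<open>g\<close> implies \<open>Emp\<close> by A8, and \<open>Emp\<close> implies
  the derivable implication by \<open>necessitation\<close>.\<close>

lemma imp_weaken:
  assumes "\<turnstile> t \<^bold>\<Rightarrow> u" "is_object g"
  shows "\<turnstile> g \<^bold>\<Rightarrow> (t \<^bold>\<Rightarrow> u)"
proof -
  have "\<turnstile> g \<^bold>\<Rightarrow> \<^bold>\<emptyset>"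
    by (rule derivable_instance[of "\<lambda>a _ _ _. a \<^bold>\<Rightarrow> \<^bold>\<emptyset>" g g g g]) (use assms in \<open>auto intro: A8\<close>)
  then show ?thesis
    using imp_trans necessitation[OF assms(1)] by blast
qed

lemma imp_Fed:
  assumes "\<turnstile> g \<^bold>\<Rightarrow> t" "\<turnstile> g \<^bold>\<Rightarrow> u"
  shows "\<turnstile> g \<^bold>\<Rightarrow> (t \<^bold>& u)"
  by (rule R1[OF Fed_imp_intro[OF assms]],
      rule derivable_instance[of "\<lambda>a b c _. ((c \<^bold>\<Rightarrow> a) \<^bold>& (c \<^bold>\<Rightarrow> b)) \<^bold>\<Rightarrow> (c \<^bold>\<Rightarrow> (a \<^bold>& b))" t u g g])
    (use assms[THEN derivable_is_object] in \<open>auto intro: A3\<close>)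

lemma Cap_imp:
  assumes "\<turnstile> t \<^bold>\<Rightarrow> g" "\<turnstile> u \<^bold>\<Rightarrow> g"
  shows "\<turnstile> (t \<^bold>\<inter> u) \<^bold>\<Rightarrow> g"
  by (rule R1[OF Fed_imp_intro[OF assms]],
      rule derivable_instance[of "\<lambda>a b c _. ((a \<^bold>\<Rightarrow> c) \<^bold>& (b \<^bold>\<Rightarrow> c)) \<^bold>\<Rightarrow> ((a \<^bold>\<inter> b) \<^bold>\<Rightarrow> c)" t u g g])
    (use assms[THEN derivable_is_object] in \<open>auto intro: A6\<close>)

lemma
  assumes "is_object t" "is_object u"
  shows Fed_imp_left: "\<turnstile> (t \<^bold>& u) \<^bold>\<Rightarrow> t"
    and Fed_imp_right: "\<turnstile> (t \<^bold>& u) \<^bold>\<Rightarrow> u"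
    and imp_Cap_left: "\<turnstile> t \<^bold>\<Rightarrow> (t \<^bold>\<inter> u)"
    and imp_Cap_right: "\<turnstile> u \<^bold>\<Rightarrow> (t \<^bold>\<inter> u)"
  by (rule derivable_instance[of "\<lambda>a b _ _. (a \<^bold>& b) \<^bold>\<Rightarrow> a" t u t t]
      derivable_instance[of "\<lambda>a b _ _. (a \<^bold>& b) \<^bold>\<Rightarrow> b" t u t t]
      derivable_instance[of "\<lambda>a b _ _. a \<^bold>\<Rightarrow> (a \<^bold>\<inter> b)" t u t t]
      derivable_instance[of "\<lambda>a b _ _. b \<^bold>\<Rightarrow> (a \<^bold>\<inter> b)" t u t t];
      use assms in \<open>auto intro: A4l A4r A5l A5r\<close>)+

section \<open>Classes and membership\<close>

lemma
  assumes "is_object A" "is_var x" "\<not> free_in x A" "is_var b" "b \<noteq> x"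
  shows imp_class_of_elements: "\<turnstile> A \<^bold>\<Rightarrow> \<^bold>{x \<^bold>| x \<^bold>\<in>[b] A\<^bold>}"
    and class_of_elements_imp: "\<turnstile> (\<^bold>V \<^bold>\<Rightarrow> A) \<^bold>\<Rightarrow> (\<^bold>{x \<^bold>| x \<^bold>\<in>[b] A\<^bold>} \<^bold>\<Rightarrow> A)"
proof -
  \<comment> \<open>A14a and A14b are taken at a variable \<open>a\<close> and then instantiated to
    \<open>A\<close>. With \<open>a\<close> different from \<open>x\<close> the substitution passes
    under the binder, and with \<open>a\<close> different from \<open>b\<close> it leaves the
    auxiliary variable of \<open>Sing\<close> alone.\<close>
  obtain a where a: "is_var a" "a \<noteq> x" "a \<noteq> b"
    using ex_fresh[of "{x, b}" "\<^bold>\<emptyset>"] by auto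
  note s = subst_ClassOf subst_Univ subst_Mem subst_is_var
  show "\<turnstile> A \<^bold>\<Rightarrow> \<^bold>{x \<^bold>| x \<^bold>\<in>[b] A\<^bold>}"
    using R2[OF A14a[OF a(1) assms(4,2,5) a(2)] a(1) assms(1)] assms a by (auto simp: s)
  show "\<turnstile> (\<^bold>V \<^bold>\<Rightarrow> A) \<^bold>\<Rightarrow> (\<^bold>{x \<^bold>| x \<^bold>\<in>[b] A\<^bold>} \<^bold>\<Rightarrow> A)"
    using R2[OF A14b[OF a(1) assms(4,2,5) a(2)] a(1) assms(1)] assms a by (auto simp: s)
qed

text \<open>R3 with the context \<open>Emp\<close>, in which no variable is free.\<close>

lemma ClassOf_antimono:
  assumes "\<turnstile> t \<^bold>\<Rightarrow> u" "is_var x"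
  shows "\<turnstile> \<^bold>{x \<^bold>| u\<^bold>} \<^bold>\<Rightarrow> \<^bold>{x \<^bold>| t\<^bold>}"
  using R1[OF derivable_Emp R3[OF necessitation]] assms by simp

text \<open>The \<open>Sing\<close> component is kept, and the component
  \<open>u \<Rightarrow> a\<close> is composed with \<open>t \<Rightarrow> u\<close>.\<close>

lemma Mem_antimono:
  assumes "\<turnstile> t \<^bold>\<Rightarrow> u" "is_object a" "is_object b"
  shows "\<turnstile> (a \<^bold>\<in>[b] u) \<^bold>\<Rightarrow> (a \<^bold>\<in>[b] t)"
proof -
  have obj: "is_object (Sing b a)" "is_object (u \<^bold>\<Rightarrow> a)"
    using assms derivable_imp_is_object by auto
  \<comment> \<open>The membership itself serves as the context for A2: it yields
    \<open>u \<Rightarrow> a\<close> by projection and \<open>t \<Rightarrow> u\<close> by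
    weakening.\<close>
  have "\<turnstile> (a \<^bold>\<in>[b] u) \<^bold>\<Rightarrow> (t \<^bold>\<Rightarrow> a)"
    unfolding Mem_def using Fed_imp_right[OF obj] imp_weaken[OF assms(1)] obj
    by (intro imp_trans_under[of _ t u a]) auto
  then show ?thesis
    unfolding Mem_def using Fed_imp_left[OF obj] imp_Fed by blast
qed

theorem theorem3p16:
  fixes A B x b :: obj
  assumes "is_object A" and "is_object B"
    and "is_var x" and "\<not> free_in x A" and "\<not> free_in x B"
    and "is_var b" and "b \<noteq> x"
  shows "\<turnstile> (SetObj A \<^bold>& SetObj B) \<^bold>\<Rightarrow>
           ((A \<^bold>\<inter> B) \<^bold>= \<^bold>{x \<^bold>| (x \<^bold>\<in>[b] A) \<^bold>& (x \<^bold>\<in>[b] B)\<^bold>})"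
proof -
  let ?G = "SetObj A \<^bold>& SetObj B"
  let ?C = "\<^bold>{x \<^bold>| (x \<^bold>\<in>[b] A) \<^bold>& (x \<^bold>\<in>[b] B)\<^bold>}"
  let ?D = "\<^bold>{x \<^bold>| x \<^bold>\<in>[b] (A \<^bold>\<inter> B)\<^bold>}"
  note vars = is_var_is_object[OF assms(3)] is_var_is_object[OF assms(6)]
  have obj: "is_object (x \<^bold>\<in>[b] A)" "is_object (x \<^bold>\<in>[b] B)"
    using assms vars by auto
  have sets: "is_object (SetObj A)" "is_object (SetObj B)"
    using assms by (auto simp: SetObj_def is_object_Univ)
  \<comment> \<open>The class of elements of \<open>A\<close> lies in between: A14a leads to it, and
    the projection of the federation onto its left part, reversed by class formation, leads on to
    \<open>?C\<close>.\<close>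
  have "\<turnstile> A \<^bold>\<Rightarrow> ?C"
    using imp_trans[OF imp_class_of_elements ClassOf_antimono[OF Fed_imp_left[OF obj]]] assms
    by blast
  moreover have "\<turnstile> B \<^bold>\<Rightarrow> ?C"
    using imp_trans[OF imp_class_of_elements ClassOf_antimono[OF Fed_imp_right[OF obj]]] assms
    by blast
  ultimately have Cap_C: "\<turnstile> ?G \<^bold>\<Rightarrow> ((A \<^bold>\<inter> B) \<^bold>\<Rightarrow> ?C)"
    using Cap_imp imp_weaken sets by simp
  \<comment> \<open>Two reversals occur: A5 gives that membership in the intersection implies both
    memberships, and class formation turns this around.\<close>
  have "\<turnstile> ?C \<^bold>\<Rightarrow> ?D"
    using imp_Fed[OF Mem_antimono[OF imp_Cap_left] Mem_antimono[OF imp_Cap_right]]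
      ClassOf_antimono assms vars by blast
  then have C_D: "\<turnstile> ?G \<^bold>\<Rightarrow> (?C \<^bold>\<Rightarrow> ?D)"
    using imp_weaken sets by simp
  \<comment> \<open>Under \<open>?G\<close>, the hypothesis that \<open>A\<close> is a set composes
    with A5 to make the intersection a set, as A14b demands.\<close>
  have "\<turnstile> ?G \<^bold>\<Rightarrow> (A \<^bold>\<Rightarrow> (A \<^bold>\<inter> B))"
    using imp_weaken imp_Cap_left assms sets by simp
  then have "\<turnstile> ?G \<^bold>\<Rightarrow> (\<^bold>V \<^bold>\<Rightarrow> (A \<^bold>\<inter> B))"
    using Fed_imp_left[OF sets] imp_trans_under unfolding SetObj_def by blast
  moreover have "\<turnstile> (\<^bold>V \<^bold>\<Rightarrow> (A \<^bold>\<inter> B)) \<^bold>\<Rightarrow> (?D \<^bold>\<Rightarrow> (A \<^bold>\<inter> B))"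
    using class_of_elements_imp assms by simp
  ultimately have "\<turnstile> ?G \<^bold>\<Rightarrow> (?D \<^bold>\<Rightarrow> (A \<^bold>\<inter> B))"
    using imp_trans by blast
  then have "\<turnstile> ?G \<^bold>\<Rightarrow> (?C \<^bold>\<Rightarrow> (A \<^bold>\<inter> B))"
    using C_D imp_trans_under by blast
  then show ?thesis
    unfolding Eq_def using Cap_C imp_Fed by blast
qed

end
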